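(* Let $\xi_1,\ldots,\xi_n$ be real random variables independent of the $\mathcal{X}$-valued random variables $X_1,\ldots,X_n$. Let $\{\mathcal{F}_k\}_{k=1}^n$ be a sequence of classes of real-valued measurable functions on $\mathcal{X}$ such that $\mathcal{F}_k\supset\mathcal{F}_n$ for every $1\le k\le n$. Suppose that either of the following conditions holds: (A1) $X_1,\ldots,X_n$ are i.i.d. with law $P$ on $(\mathcal{X},\mathcal{A})$ and $\mathcal{F}_n$ is $P$-centered; or (A2) $X_1,\ldots,X_n$ are permutation invariant and $\xi_1,\ldots,\xi_n$ are independent mean-zero random variables. Assume further that there is a non-decreasing concave function $\psi_n:[0,\infty)\to[0,\infty)$ with $\psi_n(0)=0$ such that $$\mathbb{E}\sup_{f\in\mathcal{F}_k}\Big|\sum_{i=1}^k\epsilon_i f(X_i)\Big|\le\psi_n(k)\qquad\text{for all }1\le k\le n.$$ Then $$\mathbb{E}\sup_{f\in\mathcal{F}_n}\Big|\sum_{i=1}^n\xi_i f(X_i)\Big|\le 4\int_0^\infty\psi_n\Big(\sum_{i=1}^n\mathbb{P}(|\xi_i|>t)\Big)\,dt.$$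
   Context: $\epsilon_1,\ldots,\epsilon_n$ are i.i.d. Rademacher random variables ($\mathbb{P}(\epsilon_i=\pm1)=1/2$) independent of all other random variables. The vectors $(\xi_1,\dots,\xi_n)$ and $(X_1,\dots,X_n)$ are independent; under (A1) the $\xi_i$'s may be arbitrarily dependent on each other. A class $\mathcal{F}$ is $P$-centered if $Pf=\int f\,dP=0$ for all $f\in\mathcal{F}$. "Permutation invariant" means that the joint law of $(X_1,\ldots,X_n)$ is invariant under permutations of the coordinates. All function classes are assumed countable (to avoid measurability issues). *)

theory Defs
  imports "HOL-Probability.Probability"
begin

text \<open>The library constant \<^term>\<open>prob_space.indep_var\<close> forces both random variables to take values
  in the same type. The following is its verbatim analogue for two possibly different value types:
  independence of the generated \<open>\<sigma>\<close>-algebras.\<close>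

definition indep_rvs ::
  "'a measure \<Rightarrow> 'b measure \<Rightarrow> ('a \<Rightarrow> 'b) \<Rightarrow> 'c measure \<Rightarrow> ('a \<Rightarrow> 'c) \<Rightarrow> bool" where
  "indep_rvs M S Y T Z \<longleftrightarrow> Y \<in> measurable M S \<and> Z \<in> measurable M T \<and>
     prob_space.indep_set M (sets (vimage_algebra (space M) Y S)) (sets (vimage_algebra (space M) Z T))"

definition rand_vec :: "nat \<Rightarrow> (nat \<Rightarrow> 'a \<Rightarrow> 'b) \<Rightarrow> 'a \<Rightarrow> nat \<Rightarrow> 'b" where
  "rand_vec n Y \<omega> = (\<lambda>i\<in>{1..n}. Y i \<omega>)"

abbreviation vec_space :: "nat \<Rightarrow> 'b measure \<Rightarrow> (nat \<Rightarrow> 'b) measure" where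
  "vec_space n S \<equiv> PiM {1..n} (\<lambda>_. S)"

definition rademacher :: "'a measure \<Rightarrow> ('a \<Rightarrow> real) \<Rightarrow> bool" where
  "rademacher M e \<longleftrightarrow> e \<in> borel_measurable M \<and>
     measure M {\<omega> \<in> space M. e \<omega> = 1} = 1 / 2 \<and>
     measure M {\<omega> \<in> space M. e \<omega> = -1} = 1 / 2"

definition iid_with_law ::
  "'a measure \<Rightarrow> 'b measure \<Rightarrow> nat \<Rightarrow> (nat \<Rightarrow> 'a \<Rightarrow> 'b) \<Rightarrow> 'b measure \<Rightarrow> bool" where
  "iid_with_law M S n X P \<longleftrightarrow> prob_space.indep_vars M (\<lambda>_. S) X {1..n} \<and>
     (\<forall>i\<in>{1..n}. distr M S (X i) = P)"

definition permutation_invariant ::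
  "'a measure \<Rightarrow> 'b measure \<Rightarrow> nat \<Rightarrow> (nat \<Rightarrow> 'a \<Rightarrow> 'b) \<Rightarrow> bool" where
  "permutation_invariant M S n X \<longleftrightarrow> (\<forall>\<pi>. \<pi> permutes {1..n} \<longrightarrow>
     distr M (vec_space n S) (rand_vec n (\<lambda>i. X (\<pi> i))) = distr M (vec_space n S) (rand_vec n X))"

text \<open>Integrability is required explicitly in the next two definitions, since the Bochner integral
  of a non-integrable function is 0 by convention.\<close>

definition mean_zero :: "'a measure \<Rightarrow> ('a \<Rightarrow> real) \<Rightarrow> bool" where
  "mean_zero M Z \<longleftrightarrow> integrable M Z \<and> (\<integral>\<omega>. Z \<omega> \<partial>M) = 0"

definition centered_class :: "'b measure \<Rightarrow> ('b \<Rightarrow> real) set \<Rightarrow> bool" where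
  "centered_class P F \<longleftrightarrow> (\<forall>f\<in>F. integrable P f \<and> (\<integral>x. f x \<partial>P) = 0)"

text \<open>\<open>E sup\<^sub>f \<bar>\<Sum>\<^sub>i c\<^sub>i f(X\<^sub>i)\<bar>\<close> over \<open>f \<in> F\<close> and \<open>i = 1..k\<close>, as an extended nonnegative real: the supremum
  and its expectation may be infinite, and the supremum over the empty class is 0.\<close>

definition expected_sup ::
  "'a measure \<Rightarrow> nat \<Rightarrow> (nat \<Rightarrow> 'a \<Rightarrow> real) \<Rightarrow> (nat \<Rightarrow> 'a \<Rightarrow> 'b) \<Rightarrow> ('b \<Rightarrow> real) set \<Rightarrow> ennreal" where
  "expected_sup M k c X F =
     (\<integral>\<^sup>+\<omega>. (SUP f\<in>F. ennreal \<bar>\<Sum>i=1..k. c i \<omega> * f (X i \<omega>)\<bar>) \<partial>M)"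

end

theory Submission
  imports Defs
begin

text \<open>
  Condition on the multipliers \<open>\<xi>\<close>, which are independent of the sample \<open>X\<close>. The proof has three
  ingredients.

  First, random signs are inserted at the cost of a factor two. If \<open>Z\<^sub>1, \<dots>, Z\<^sub>n\<close> are independent and
  centered, then dropping some of the summands does not increase the mean norm of their sum, by
  Jensen's inequality (\<open>nn_integral_unif_norm_subset_le\<close>). Splitting the sum into the part with sign
  \<open>+1\<close> and the part with sign \<open>-1\<close> gives \<open>E\<parallel>\<Sum> Z\<^sub>i\<parallel> \<le> 2 E\<parallel>\<Sum> s\<^sub>i Z\<^sub>i\<parallel>\<close> for every fixed sign vector \<open>s\<close>
  (\<open>desymmetrization\<close>). For a centered class and an i.i.d. sample this is applied with \<open>\<xi>\<close> fixed,
  for independent centered multipliers with \<open>X\<close> fixed. The result is then averaged over all \<open>2\<^sup>n\<close>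
  sign vectors.

  Second, the weights are removed. For fixed weights \<open>c\<close> their signs are absorbed by the average
  over \<open>s\<close>, and \<open>\<bar>c\<^sub>i\<bar> = \<integral>\<^sub>0\<^sup>\<infinity> 1{\<bar>c\<^sub>i\<bar> > t} dt\<close> bounds the weighted norm by the integral over \<open>t\<close> of
  the norms of \<open>\<Sum> s\<^sub>i f(X\<^sub>i)\<close> over the exceedance set \<open>{i. \<bar>c\<^sub>i\<bar> > t}\<close>
  (\<open>sum_sign_vectors_unif_norm_le_layers\<close>). The sample is exchangeable in both cases, so an average over
  an index set of size \<open>k\<close> equals the one over \<open>{1..k}\<close>, which is at most \<open>\<psi>(k)\<close> by assumption
  (\<open>sum_sign_vectors_subset_le\<close>). This replaces the usual ordering of the multipliers by size and
  summation by parts.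

  Third, integrate over \<open>\<xi>\<close> and use concavity: the mean of \<open>\<psi>\<close> at the number of exceedances of \<open>t\<close>
  is at most \<open>\<psi>\<close> at the mean number \<open>\<Sum> P(\<bar>\<xi>\<^sub>i\<bar> > t)\<close> (\<open>nn_integral_layers_le\<close>). This argument gives
  the constant \<open>2\<close>, which is weakened to \<open>4\<close> in the last step.
\<close>

section \<open>Independence and decoupling\<close>

lemma indep_var_imp_indep_rvs:
  assumes "prob_space M" and "prob_space.indep_var M S Y T Z"
  shows "indep_rvs M S Y T Z"
proof -
  interpret prob_space M by fact
  from assms(2) have m: "Y \<in> measurable M S" "Z \<in> measurable M T"
    by (auto dest: indep_var_rv1 indep_var_rv2)
  have s: "sigma_sets (space M) {Y -` A \<inter> space M |A. A \<in> sets N} = sets (vimage_algebra (space M) Y N)"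
    for Y N by (simp add: sets_vimage_algebra)
  show ?thesis
    using assms(2) m unfolding indep_var_eq indep_rvs_def s by simp
qed

lemma indep_rvs_compose:
  assumes "prob_space M" and YZ: "indep_rvs M S Y T Z" and h: "h \<in> measurable T T'"
  shows "indep_rvs M S Y T' (\<lambda>\<omega>. h (Z \<omega>))"
proof -
  interpret prob_space M by fact
  have Y: "Y \<in> measurable M S" and Z: "Z \<in> measurable M T"
    and ind: "indep_set (sets (vimage_algebra (space M) Y S)) (sets (vimage_algebra (space M) Z T))"
    using YZ by (auto simp: indep_rvs_def)
  have hZ: "(\<lambda>\<omega>. h (Z \<omega>)) \<in> measurable M T'"
    using Z h by (rule measurable_compose)
  have "sets (vimage_algebra (space M) (\<lambda>\<omega>. h (Z \<omega>)) T') \<subseteq> sets (vimage_algebra (space M) Z T)"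
  proof
    fix B assume "B \<in> sets (vimage_algebra (space M) (\<lambda>\<omega>. h (Z \<omega>)) T')"
    then obtain A where A: "A \<in> sets T'" "B = (\<lambda>\<omega>. h (Z \<omega>)) -` A \<inter> space M"
      using measurable_space[OF hZ] by (subst (asm) sets_vimage_algebra2) auto
    then have B: "B = Z -` (h -` A \<inter> space T) \<inter> space M"
      using measurable_space[OF Z] by auto
    then show "B \<in> sets (vimage_algebra (space M) Z T)"
      unfolding B by (intro in_vimage_algebra measurable_sets[OF h A(1)])
  qed
  with ind have "indep_set (sets (vimage_algebra (space M) Y S)) (sets (vimage_algebra (space M) (\<lambda>\<omega>. h (Z \<omega>)) T'))"
    unfolding indep_sets2_eq by blast
  with Y hZ show ?thesis by (simp add: indep_rvs_def)
qed

lemma indep_rvs_rand_vecD: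
  assumes "indep_rvs M (vec_space n N) (rand_vec n Y) (vec_space n S) (rand_vec n X)" and i: "i \<in> {1..n}"
  shows "Y i \<in> measurable M N" and "X i \<in> measurable M S"
proof -
  have m: "rand_vec n Y \<in> measurable M (vec_space n N)" "rand_vec n X \<in> measurable M (vec_space n S)"
    using assms(1) by (auto simp: indep_rvs_def)
  show "Y i \<in> measurable M N" "X i \<in> measurable M S"
    using measurable_compose[OF m(1) measurable_component_singleton[OF i]]
      measurable_compose[OF m(2) measurable_component_singleton[OF i]] i
    by (simp_all add: rand_vec_def)
qed

text \<open>Independence says that the joint law is the product of the marginal laws, so one of the two
  variables may be replaced by a fresh copy on a second factor of the probability space. All later
  conditioning arguments become iterated integrals through this fact.\<close>

lemma nn_integral_decouple:
  assumes "prob_space M"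
    and "indep_rvs M S Y T Z"
    and g: "g \<in> borel_measurable (S \<Otimes>\<^sub>M T)"
  shows "(\<integral>\<^sup>+\<omega>. g (Y \<omega>, Z \<omega>) \<partial>M) = (\<integral>\<^sup>+\<omega>. (\<integral>\<^sup>+\<omega>'. g (Y \<omega>, Z \<omega>') \<partial>M) \<partial>M)"
proof -
  interpret prob_space M by fact
  have Y [measurable]: "Y \<in> measurable M S" and Z [measurable]: "Z \<in> measurable M T"
    and ind: "indep_set (sets (vimage_algebra (space M) Y S)) (sets (vimage_algebra (space M) Z T))"
    using assms(2) by (auto simp: indep_rvs_def)
  interpret DY: prob_space "distr M S Y" by (rule prob_space_distr) fact
  interpret DZ: prob_space "distr M T Z" by (rule prob_space_distr) fact
  have law: "distr M S Y \<Otimes>\<^sub>M distr M T Z = distr M (S \<Otimes>\<^sub>M T) (\<lambda>\<omega>. (Y \<omega>, Z \<omega>))"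
  proof (rule pair_measure_eqI)
    fix A B assume "A \<in> sets (distr M S Y)" "B \<in> sets (distr M T Z)"
    then have [measurable]: "A \<in> sets S" "B \<in> sets T" by auto
    have "prob ((Y -` A \<inter> space M) \<inter> (Z -` B \<inter> space M))
        = prob (Y -` A \<inter> space M) * prob (Z -` B \<inter> space M)"
      by (rule indep_setD[OF ind]) (auto intro: in_vimage_algebra)
    moreover have "(\<lambda>\<omega>. (Y \<omega>, Z \<omega>)) -` (A \<times> B) \<inter> space M
        = (Y -` A \<inter> space M) \<inter> (Z -` B \<inter> space M)" by auto
    ultimately show "emeasure (distr M S Y) A * emeasure (distr M T Z) B
        = emeasure (distr M (S \<Otimes>\<^sub>M T) (\<lambda>\<omega>. (Y \<omega>, Z \<omega>))) (A \<times> B)"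
      by (simp add: emeasure_distr emeasure_eq_measure ennreal_mult)
  qed (auto intro: DY.sigma_finite_measure_axioms DZ.sigma_finite_measure_axioms)
  have "(\<integral>\<^sup>+\<omega>. g (Y \<omega>, Z \<omega>) \<partial>M) = (\<integral>\<^sup>+p. g p \<partial>distr M (S \<Otimes>\<^sub>M T) (\<lambda>\<omega>. (Y \<omega>, Z \<omega>)))"
    using g by (subst nn_integral_distr) auto
  also have "\<dots> = (\<integral>\<^sup>+p. g p \<partial>(distr M S Y \<Otimes>\<^sub>M distr M T Z))"
    by (simp add: law)
  also have "\<dots> = (\<integral>\<^sup>+y. (\<integral>\<^sup>+z. g (y, z) \<partial>distr M T Z) \<partial>distr M S Y)"
    using g by (intro DZ.nn_integral_fst[symmetric])
      (simp add: measurable_cong_sets[OF sets_pair_measure_cong[OF sets_distr sets_distr] refl])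
  also have "\<dots> = (\<integral>\<^sup>+y. (\<integral>\<^sup>+\<omega>'. g (y, Z \<omega>') \<partial>M) \<partial>distr M S Y)"
    using g by (intro nn_integral_cong nn_integral_distr) (auto intro: measurable_Pair2)
  also have "\<dots> = (\<integral>\<^sup>+\<omega>. (\<integral>\<^sup>+\<omega>'. g (Y \<omega>, Z \<omega>') \<partial>M) \<partial>M)"
    using g by (intro nn_integral_distr) (auto)
  finally show ?thesis .
qed

section \<open>Uniform norms over a function class\<close>

text \<open>The norm of \<open>\<ell>\<^sup>\<infinity>(F)\<close>, with values in the extended reals; the index set is an arbitrary
  type because the integrands below depend on a function \<open>f\<close> and a sample point in various ways.\<close>

abbreviation unif_norm :: "'f set \<Rightarrow> ('f \<Rightarrow> real) \<Rightarrow> ennreal" where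
  "unif_norm F u \<equiv> (SUP f\<in>F. ennreal \<bar>u f\<bar>)"

lemma borel_measurable_unif_norm:
  assumes "countable F" and "\<And>f. f \<in> F \<Longrightarrow> u f \<in> borel_measurable N"
  shows "(\<lambda>x. unif_norm F (\<lambda>f. u f x)) \<in> borel_measurable N"
  using assms by (intro borel_measurable_SUP measurable_compose[OF _ measurable_ennreal] borel_measurable_abs)

lemma unif_norm_triangle:
  "unif_norm F (\<lambda>f. u f + v f) \<le> unif_norm F u + unif_norm F v"
proof (rule SUP_least)
  fix f assume "f \<in> F"
  have "ennreal \<bar>u f + v f\<bar> \<le> ennreal \<bar>u f\<bar> + ennreal \<bar>v f\<bar>"
    by (simp flip: ennreal_plus)
  also have "\<dots> \<le> unif_norm F u + unif_norm F v"
    using \<open>f \<in> F\<close> by (intro add_mono SUP_upper)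
  finally show "ennreal \<bar>u f + v f\<bar> \<le> unif_norm F u + unif_norm F v" .
qed

text \<open>Jensen's inequality for the uniform norm: for each \<open>f\<close> the number \<open>u f\<close> is the mean of
  \<open>u f + v f\<close>, and a supremum of means is at most the mean of the supremum.\<close>

lemma unif_norm_le_nn_integral_add_centered:
  assumes "prob_space M"
    and "\<And>f. f \<in> F \<Longrightarrow> integrable M (v f)"
    and "\<And>f. f \<in> F \<Longrightarrow> (\<integral>\<omega>. v f \<omega> \<partial>M) = 0"
  shows "unif_norm F u \<le> (\<integral>\<^sup>+\<omega>. unif_norm F (\<lambda>f. u f + v f \<omega>) \<partial>M)"
proof (rule SUP_least)
  fix f assume "f \<in> F"
  interpret prob_space M by fact
  have int: "integrable M (\<lambda>\<omega>. u f + v f \<omega>)" using assms(2)[OF \<open>f \<in> F\<close>] by simp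
  have "u f = (\<integral>\<omega>. u f + v f \<omega> \<partial>M)"
    using assms(2,3)[OF \<open>f \<in> F\<close>] by (simp add: prob_space)
  then have "ennreal \<bar>u f\<bar> \<le> (\<integral>\<^sup>+\<omega>. ennreal \<bar>u f + v f \<omega>\<bar> \<partial>M)"
    using integral_norm_bound_ennreal[OF int] by simp
  also have "\<dots> \<le> (\<integral>\<^sup>+\<omega>. unif_norm F (\<lambda>f. u f + v f \<omega>) \<partial>M)"
    using \<open>f \<in> F\<close> by (intro nn_integral_mono SUP_upper)
  finally show "ennreal \<bar>u f\<bar> \<le> (\<integral>\<^sup>+\<omega>. unif_norm F (\<lambda>f. u f + v f \<omega>) \<partial>M)" .
qed

section \<open>Averages over sign vectors\<close>

definition sign_vectors :: "'i set \<Rightarrow> ('i \<Rightarrow> real) set" where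
  "sign_vectors I = PiE I (\<lambda>_. {-1, 1})"

lemma finite_sign_vectors: "finite I \<Longrightarrow> finite (sign_vectors I)"
  by (simp add: sign_vectors_def finite_PiE)

lemma sign_vectorsD: "s \<in> sign_vectors I \<Longrightarrow> i \<in> I \<Longrightarrow> s i = 1 \<or> s i = -1"
  by (auto simp: sign_vectors_def PiE_def)

lemma card_sign_vectors: "finite I \<Longrightarrow> card (sign_vectors I) = 2 ^ card I"
  by (simp add: sign_vectors_def card_PiE numeral_2_eq_2)

lemma sum_sign_vectors_permute:
  assumes p: "p permutes I"
  shows "(\<Sum>s\<in>sign_vectors I. \<Phi> (\<lambda>i\<in>I. s (p i))) = (\<Sum>s\<in>sign_vectors I. \<Phi> s)"
proof (rule sum.reindex_bij_witness[where i = "\<lambda>s. \<lambda>i\<in>I. s (inv p i)" and j = "\<lambda>s. \<lambda>i\<in>I. s (p i)"])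
  fix s assume s: "s \<in> sign_vectors I"
  have pI: "p i \<in> I \<longleftrightarrow> i \<in> I" "inv p i \<in> I \<longleftrightarrow> i \<in> I" for i
    using permutes_in_image[OF p] permutes_in_image[OF permutes_inv[OF p]] by auto
  have out: "s i = undefined" if "i \<notin> I" for i
    using s that by (auto simp: sign_vectors_def PiE_def extensional_def)
  show "(\<lambda>i\<in>I. (\<lambda>i\<in>I. s (p i)) (inv p i)) = s"
    by (rule ext) (simp add: restrict_def pI out permutes_inverses[OF p])
  show "(\<lambda>i\<in>I. (\<lambda>i\<in>I. s (inv p i)) (p i)) = s"
    by (rule ext) (simp add: restrict_def pI out permutes_inverses[OF p])
  show "(\<lambda>i\<in>I. s (p i)) \<in> sign_vectors I" 
    unfolding sign_vectors_def using sign_vectorsD[OF s] pI by (intro restrict_PiE_iff[THEN iffD2]) auto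
  show "(\<lambda>i\<in>I. s (inv p i)) \<in> sign_vectors I" 
    unfolding sign_vectors_def using sign_vectorsD[OF s] pI by (intro restrict_PiE_iff[THEN iffD2]) auto
qed auto

lemma sum_sign_vectors_flip:
  assumes \<sigma>: "\<And>i. i \<in> I \<Longrightarrow> \<sigma> i = 1 \<or> \<sigma> i = -1"
  shows "(\<Sum>s\<in>sign_vectors I. \<Phi> (\<lambda>i\<in>I. s i * \<sigma> i)) = (\<Sum>s\<in>sign_vectors I. \<Phi> s)"
proof (rule sum.reindex_bij_witness[where i = "\<lambda>s. \<lambda>i\<in>I. s i * \<sigma> i" and j = "\<lambda>s. \<lambda>i\<in>I. s i * \<sigma> i"])
  fix s assume s: "s \<in> sign_vectors I"
  have *: "\<sigma> i * \<sigma> i = 1" if "i \<in> I" for i using \<sigma>[OF that] by auto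
  have out: "s i = undefined" if "i \<notin> I" for i
    using s that by (auto simp: sign_vectors_def PiE_def extensional_def)
  show "(\<lambda>i\<in>I. (\<lambda>i\<in>I. s i * \<sigma> i) i * \<sigma> i) = s"
    by (rule ext) (simp add: restrict_def out mult.assoc *)
  then show "(\<lambda>i\<in>I. (\<lambda>i\<in>I. s i * \<sigma> i) i * \<sigma> i) = s" .
  show "(\<lambda>i\<in>I. s i * \<sigma> i) \<in> sign_vectors I"
    unfolding sign_vectors_def using sign_vectorsD[OF s] \<sigma> by (intro restrict_PiE_iff[THEN iffD2]) fastforce
  then show "(\<lambda>i\<in>I. s i * \<sigma> i) \<in> sign_vectors I" .
qed auto

text \<open>Each sign vector is attained by \<open>\<epsilon>\<close> with probability \<open>2\<^sup>-\<^sup>n\<close>. Only this inequality is stated,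
  because it follows from comparing the integrand with a simple function and so holds for every
  \<open>\<Phi>\<close>, measurable or not.\<close>

lemma sum_sign_vectors_le_rademacher_average:
  fixes \<epsilon> :: "nat \<Rightarrow> 'a \<Rightarrow> real" and \<Phi> :: "(nat \<Rightarrow> real) \<Rightarrow> ennreal"
  assumes "prob_space M" and "n \<ge> 1"
    and ind: "prob_space.indep_vars M (\<lambda>_. borel) \<epsilon> {1..n}"
    and rad: "\<And>i. i \<in> {1..n} \<Longrightarrow> rademacher M (\<epsilon> i)"
  shows "(\<Sum>s\<in>sign_vectors {1..n}. \<Phi> s) \<le> 2 ^ n * (\<integral>\<^sup>+\<omega>. \<Phi> (rand_vec n \<epsilon> \<omega>) \<partial>M)"
proof -
  interpret prob_space M by fact
  let ?S = "sign_vectors {1..n}"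
  have em [measurable]: "\<epsilon> i \<in> borel_measurable M" if "i \<in> {1..n}" for i
    using rad[OF that] by (simp add: rademacher_def)
  define E where "E s = (\<Inter>i\<in>{1..n}. \<epsilon> i -` {s i} \<inter> space M)" for s
  have E: "E s \<in> events" for s
    unfolding E_def using \<open>n \<ge> 1\<close> em by (intro sets.finite_INT) auto
  have prob_E: "emeasure M (E s) = ennreal ((1/2) ^ n)" if s: "s \<in> ?S" for s
  proof -
    have "prob (E s) = (\<Prod>i\<in>{1..n}. prob (\<epsilon> i -` {s i} \<inter> space M))"
      unfolding E_def using \<open>n \<ge> 1\<close> by (intro indep_varsD[OF ind]) auto
    also have "\<dots> = (\<Prod>i\<in>{1..n}. 1/2)"
    proof (rule prod.cong)
      fix i assume i: "i \<in> {1..n}"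
      have "\<epsilon> i -` {s i} \<inter> space M = {\<omega> \<in> space M. \<epsilon> i \<omega> = s i}" by auto
      then show "prob (\<epsilon> i -` {s i} \<inter> space M) = 1/2"
        using rad[OF i] sign_vectorsD[OF s i] by (auto simp: rademacher_def)
    qed simp
    finally show ?thesis by (simp add: emeasure_eq_measure)
  qed
  have half: "2 ^ n * ennreal ((1/2) ^ n) = 1"
  proof -
    have "2 ^ n * ennreal ((1/2) ^ n) = ennreal (2 ^ n) * ennreal ((1/2) ^ n)"
      by (simp flip: ennreal_power)
    also have "\<dots> = ennreal (2 ^ n * (1/2) ^ n)" by (simp add: ennreal_mult)
    also have "\<dots> = 1" by (simp flip: power_mult_distrib)
    finally show ?thesis .
  qed
  have "(\<Sum>s\<in>?S. \<Phi> s) = (\<Sum>s\<in>?S. 2 ^ n * (\<Phi> s * emeasure M (E s)))"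
  proof (rule sum.cong)
    fix s assume "s \<in> ?S"
    then have "2 ^ n * (\<Phi> s * emeasure M (E s)) = \<Phi> s * (2 ^ n * ennreal ((1/2) ^ n))"
      by (simp only: prob_E mult_ac)
    then show "\<Phi> s = 2 ^ n * (\<Phi> s * emeasure M (E s))" by (simp only: half mult_1_right)
  qed simp
  also have "\<dots> = 2 ^ n * (\<integral>\<^sup>+\<omega>. (\<Sum>s\<in>?S. \<Phi> s * indicator (E s) \<omega>) \<partial>M)"
    using E by (simp add: nn_integral_sum nn_integral_cmult_indicator sum_distrib_left)
  also have "\<dots> \<le> 2 ^ n * (\<integral>\<^sup>+\<omega>. \<Phi> (rand_vec n \<epsilon> \<omega>) \<partial>M)"
  proof (intro mult_left_mono nn_integral_mono)
    fix \<omega> assume \<omega>: "\<omega> \<in> space M"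
    have "(\<Sum>s\<in>?S. \<Phi> s * indicator (E s) \<omega>)
        = (\<Sum>s\<in>?S. if s = rand_vec n \<epsilon> \<omega> then \<Phi> (rand_vec n \<epsilon> \<omega>) else 0)"
    proof (rule sum.cong)
      fix s assume s: "s \<in> ?S"
      have "\<omega> \<in> E s \<longleftrightarrow> s = rand_vec n \<epsilon> \<omega>"
        using s \<omega> \<open>n \<ge> 1\<close> by (auto simp: E_def rand_vec_def fun_eq_iff sign_vectors_def PiE_iff extensional_def)
      then show "\<Phi> s * indicator (E s) \<omega> = (if s = rand_vec n \<epsilon> \<omega> then \<Phi> (rand_vec n \<epsilon> \<omega>) else 0)"
        by (auto simp: indicator_def)
    qed simp
    also have "\<dots> \<le> \<Phi> (rand_vec n \<epsilon> \<omega>)"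
      by (simp add: finite_sign_vectors)
    finally show "(\<Sum>s\<in>?S. \<Phi> s * indicator (E s) \<omega>) \<le> \<Phi> (rand_vec n \<epsilon> \<omega>)" .
  qed simp
  finally show ?thesis .
qed

section \<open>Inserting signs into sums of independent centered terms\<close>

text \<open>The summands outside \<open>A\<close> are centered and independent of those inside, so integrating them out
  recovers the partial sum; Jensen's inequality then shows that adding them can only increase the
  mean norm.\<close>

lemma nn_integral_unif_norm_subset_le:
  fixes Y :: "'i \<Rightarrow> 'a \<Rightarrow> 'b" and h :: "'f \<Rightarrow> 'i \<Rightarrow> 'b \<Rightarrow> real"
  assumes "prob_space M" and ind: "prob_space.indep_vars M (\<lambda>_. N) Y I" and "finite I" and "A \<subseteq> I"
    and "countable F"
    and [measurable]: "\<And>f i. f \<in> F \<Longrightarrow> i \<in> I \<Longrightarrow> h f i \<in> borel_measurable N"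
    and int: "\<And>f i. f \<in> F \<Longrightarrow> i \<in> I \<Longrightarrow> integrable M (\<lambda>\<omega>. h f i (Y i \<omega>))"
    and zero: "\<And>f i. f \<in> F \<Longrightarrow> i \<in> I \<Longrightarrow> (\<integral>\<omega>. h f i (Y i \<omega>) \<partial>M) = 0"
  shows "(\<integral>\<^sup>+\<omega>. unif_norm F (\<lambda>f. \<Sum>i\<in>A. h f i (Y i \<omega>)) \<partial>M)
    \<le> (\<integral>\<^sup>+\<omega>. unif_norm F (\<lambda>f. \<Sum>i\<in>I. h f i (Y i \<omega>)) \<partial>M)"
proof -
  interpret prob_space M by fact
  define B where "B = I - A"
  have AB: "I = A \<union> B" "A \<inter> B = {}" "B \<subseteq> I" "finite A" "finite B"
    using \<open>A \<subseteq> I\<close> \<open>finite I\<close> by (auto simp: B_def intro: finite_subset)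
  define g where "g = (\<lambda>(a, b). unif_norm F (\<lambda>f. (\<Sum>i\<in>A. h f i (a i)) + (\<Sum>i\<in>B. h f i (b i))))"
  have g: "g \<in> borel_measurable (PiM A (\<lambda>_. N) \<Otimes>\<^sub>M PiM B (\<lambda>_. N))"
    unfolding g_def case_prod_beta
  proof (intro borel_measurable_SUP \<open>countable F\<close> measurable_compose[OF _ measurable_ennreal]
      borel_measurable_abs borel_measurable_add borel_measurable_sum)
    fix f i assume f: "f \<in> F" 
    show "(\<lambda>x. h f i (fst x i)) \<in> borel_measurable (PiM A (\<lambda>_. N) \<Otimes>\<^sub>M PiM B (\<lambda>_. N))" if "i \<in> A"
    proof -
      have [measurable]: "h f i \<in> borel_measurable N" using that f AB by auto
      show ?thesis using that by measurable
    qed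
    show "(\<lambda>x. h f i (snd x i)) \<in> borel_measurable (PiM A (\<lambda>_. N) \<Otimes>\<^sub>M PiM B (\<lambda>_. N))" if "i \<in> B"
    proof -
      have [measurable]: "h f i \<in> borel_measurable N" using that f AB by auto
      show ?thesis using that by measurable
    qed
  qed
  have rvs: "indep_rvs M (PiM A (\<lambda>_. N)) (\<lambda>\<omega>. restrict (\<lambda>i. Y i \<omega>) A)
      (PiM B (\<lambda>_. N)) (\<lambda>\<omega>. restrict (\<lambda>i. Y i \<omega>) B)"
    using AB by (intro indep_var_imp_indep_rvs prob_space_axioms indep_var_restrict[OF ind]) auto
  have "(\<integral>\<^sup>+\<omega>. unif_norm F (\<lambda>f. \<Sum>i\<in>A. h f i (Y i \<omega>)) \<partial>M)
      \<le> (\<integral>\<^sup>+\<omega>. (\<integral>\<^sup>+\<omega>'. unif_norm F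
            (\<lambda>f. (\<Sum>i\<in>A. h f i (Y i \<omega>)) + (\<Sum>i\<in>B. h f i (Y i \<omega>'))) \<partial>M) \<partial>M)"
  proof (intro nn_integral_mono unif_norm_le_nn_integral_add_centered prob_space_axioms)
    fix f assume f: "f \<in> F"
    have B: "integrable M (\<lambda>\<omega>. h f i (Y i \<omega>))" "(\<integral>\<omega>. h f i (Y i \<omega>) \<partial>M) = 0" if "i \<in> B" for i
      using that AB int[OF f] zero[OF f] by auto
    show "integrable M (\<lambda>\<omega>'. \<Sum>i\<in>B. h f i (Y i \<omega>'))" using B by auto
    show "(\<integral>\<omega>'. (\<Sum>i\<in>B. h f i (Y i \<omega>')) \<partial>M) = 0"
      using B by (subst Bochner_Integration.integral_sum) auto
  qed
  also have "\<dots> = (\<integral>\<^sup>+\<omega>. (\<integral>\<^sup>+\<omega>'. g (restrict (\<lambda>i. Y i \<omega>) A, restrict (\<lambda>i. Y i \<omega>') B) \<partial>M) \<partial>M)"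
    by (simp add: g_def)
  also have "\<dots> = (\<integral>\<^sup>+\<omega>. g (restrict (\<lambda>i. Y i \<omega>) A, restrict (\<lambda>i. Y i \<omega>) B) \<partial>M)"
    by (rule nn_integral_decouple[OF prob_space_axioms rvs g, symmetric])
  also have "\<dots> = (\<integral>\<^sup>+\<omega>. unif_norm F (\<lambda>f. \<Sum>i\<in>I. h f i (Y i \<omega>)) \<partial>M)"
    using AB by (simp add: g_def sum.union_disjoint)
  finally show ?thesis .
qed

text \<open>Split the sum according to the sign \<open>s i\<close>. On each of the two parts the signed and the unsigned
  sums agree up to a global sign, and each part is a partial sum of the signed sum, hence is
  dominated by it. This costs a factor of two and holds for every fixed sign vector.\<close>

lemma desymmetrization:
  fixes Y :: "'i \<Rightarrow> 'a \<Rightarrow> 'b" and h :: "'f \<Rightarrow> 'i \<Rightarrow> 'b \<Rightarrow> real" and s :: "'i \<Rightarrow> real"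
  assumes M: "prob_space M" and ind: "prob_space.indep_vars M (\<lambda>_. N) Y I" and "finite I"
    and "countable F"
    and meas: "\<And>f i. f \<in> F \<Longrightarrow> i \<in> I \<Longrightarrow> h f i \<in> borel_measurable N"
    and int: "\<And>f i. f \<in> F \<Longrightarrow> i \<in> I \<Longrightarrow> integrable M (\<lambda>\<omega>. h f i (Y i \<omega>))"
    and zero: "\<And>f i. f \<in> F \<Longrightarrow> i \<in> I \<Longrightarrow> (\<integral>\<omega>. h f i (Y i \<omega>) \<partial>M) = 0"
    and s: "\<And>i. i \<in> I \<Longrightarrow> s i = 1 \<or> s i = -1"
  shows "(\<integral>\<^sup>+\<omega>. unif_norm F (\<lambda>f. \<Sum>i\<in>I. h f i (Y i \<omega>)) \<partial>M)
    \<le> 2 * (\<integral>\<^sup>+\<omega>. unif_norm F (\<lambda>f. \<Sum>i\<in>I. s i * h f i (Y i \<omega>)) \<partial>M)"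
proof -
  interpret prob_space M by fact
  define A B where "A = {i\<in>I. s i = 1}" and "B = {i\<in>I. s i = -1}"
  have AB: "I = A \<union> B" "A \<inter> B = {}" "A \<subseteq> I" "B \<subseteq> I" "finite A" "finite B"
    using s \<open>finite I\<close> by (auto simp: A_def B_def)
  have Ym: "Y i \<in> measurable M N" if "i \<in> I" for i
    using ind that by (auto simp: indep_vars_def)
  have part: "(\<integral>\<^sup>+\<omega>. unif_norm F (\<lambda>f. \<Sum>i\<in>C. s i * h f i (Y i \<omega>)) \<partial>M)
      \<le> (\<integral>\<^sup>+\<omega>. unif_norm F (\<lambda>f. \<Sum>i\<in>I. s i * h f i (Y i \<omega>)) \<partial>M)" if "C \<subseteq> I" for C
    by (rule nn_integral_unif_norm_subset_le[OF M ind \<open>finite I\<close> that \<open>countable F\<close>,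
          where h = "\<lambda>f i y. s i * h f i y"])
      (auto intro!: borel_measurable_times meas int simp: zero)
  have um: "(\<lambda>\<omega>. unif_norm F (\<lambda>f. \<Sum>i\<in>C. s i * h f i (Y i \<omega>))) \<in> borel_measurable M"
    if "C \<subseteq> I" for C
    using that by (intro borel_measurable_SUP \<open>countable F\<close> measurable_compose[OF _ measurable_ennreal]
      borel_measurable_abs borel_measurable_sum borel_measurable_times borel_measurable_const
      measurable_compose[OF Ym meas]) auto
  have "unif_norm F (\<lambda>f. \<Sum>i\<in>I. h f i (Y i \<omega>))
      \<le> unif_norm F (\<lambda>f. \<Sum>i\<in>A. s i * h f i (Y i \<omega>)) + unif_norm F (\<lambda>f. \<Sum>i\<in>B. s i * h f i (Y i \<omega>))" for \<omega>
  proof -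
    have "unif_norm F (\<lambda>f. \<Sum>i\<in>I. h f i (Y i \<omega>))
        = unif_norm F (\<lambda>f. (\<Sum>i\<in>A. h f i (Y i \<omega>)) + (\<Sum>i\<in>B. h f i (Y i \<omega>)))"
      using AB by (simp add: sum.union_disjoint)
    also have "\<dots> \<le> unif_norm F (\<lambda>f. \<Sum>i\<in>A. h f i (Y i \<omega>)) + unif_norm F (\<lambda>f. \<Sum>i\<in>B. h f i (Y i \<omega>))"
      by (rule unif_norm_triangle)
    also have "unif_norm F (\<lambda>f. \<Sum>i\<in>A. h f i (Y i \<omega>)) = unif_norm F (\<lambda>f. \<Sum>i\<in>A. s i * h f i (Y i \<omega>))"
      by (simp add: A_def)
    also have "unif_norm F (\<lambda>f. \<Sum>i\<in>B. h f i (Y i \<omega>)) = unif_norm F (\<lambda>f. \<Sum>i\<in>B. s i * h f i (Y i \<omega>))"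
      by (simp add: B_def sum_negf)
    finally show ?thesis .
  qed
  then have "(\<integral>\<^sup>+\<omega>. unif_norm F (\<lambda>f. \<Sum>i\<in>I. h f i (Y i \<omega>)) \<partial>M)
      \<le> (\<integral>\<^sup>+\<omega>. unif_norm F (\<lambda>f. \<Sum>i\<in>A. s i * h f i (Y i \<omega>))
          + unif_norm F (\<lambda>f. \<Sum>i\<in>B. s i * h f i (Y i \<omega>)) \<partial>M)"
    by (rule nn_integral_mono)
  also have "\<dots> = (\<integral>\<^sup>+\<omega>. unif_norm F (\<lambda>f. \<Sum>i\<in>A. s i * h f i (Y i \<omega>)) \<partial>M)
      + (\<integral>\<^sup>+\<omega>. unif_norm F (\<lambda>f. \<Sum>i\<in>B. s i * h f i (Y i \<omega>)) \<partial>M)"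
    using AB by (intro nn_integral_add um)
  also have "\<dots> \<le> 2 * (\<integral>\<^sup>+\<omega>. unif_norm F (\<lambda>f. \<Sum>i\<in>I. s i * h f i (Y i \<omega>)) \<partial>M)"
    using add_mono[OF part[OF AB(3)] part[OF AB(4)]] by (simp add: mult_2)
  finally show ?thesis .
qed

text \<open>The form used for a centered class and an i.i.d. sample, with the multipliers \<open>c\<close> fixed.\<close>

lemma desymmetrization_iid:
  fixes F :: "('b \<Rightarrow> real) set"
  assumes "prob_space M" and iid: "iid_with_law M S n X P" and cent: "centered_class P F"
    and "countable F" and F: "F \<subseteq> borel_measurable S" and s: "s \<in> sign_vectors {1..n}"
  shows "(\<integral>\<^sup>+\<omega>. unif_norm F (\<lambda>f. \<Sum>i=1..n. c i * f (X i \<omega>)) \<partial>M)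
    \<le> 2 * (\<integral>\<^sup>+\<omega>. unif_norm F (\<lambda>f. \<Sum>i=1..n. s i * (c i * f (X i \<omega>))) \<partial>M)"
proof -
  interpret prob_space M by fact
  have ind: "indep_vars (\<lambda>_. S) X {1..n}" and law: "\<And>i. i \<in> {1..n} \<Longrightarrow> distr M S (X i) = P"
    using iid by (auto simp: iid_with_law_def)
  have fX: "integrable M (\<lambda>\<omega>. f (X i \<omega>))" "(\<integral>\<omega>. f (X i \<omega>) \<partial>M) = 0" if "f \<in> F" and i: "i \<in> {1..n}" for f i
  proof -
    have X: "X i \<in> measurable M S" using ind i by (auto simp: indep_vars_def)
    have f: "f \<in> borel_measurable S" using F that by auto
    have "integrable P f" "(\<integral>x. f x \<partial>P) = 0" using cent that by (auto simp: centered_class_def)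
    then show "integrable M (\<lambda>\<omega>. f (X i \<omega>))" "(\<integral>\<omega>. f (X i \<omega>) \<partial>M) = 0"
      unfolding law[OF i, symmetric] by (simp_all add: integrable_distr_eq[OF X f] integral_distr[OF X f])
  qed
  show ?thesis
    by (rule desymmetrization[OF assms(1) ind _ \<open>countable F\<close>, where h = "\<lambda>f i x. c i * f x"])
      (use F fX sign_vectorsD[OF s] in \<open>auto\<close>)
qed

text \<open>The form used for centered multipliers, with the sample points \<open>x\<close> fixed:
  each \<open>\<xi> i * f (x i)\<close> is then a scalar multiple of a centered variable.\<close>

lemma desymmetrization_multipliers:
  fixes n :: nat
  assumes "prob_space M" and ind: "prob_space.indep_vars M (\<lambda>_. borel) \<xi> {1..n}"
    and zero: "\<And>i. i \<in> {1..n} \<Longrightarrow> mean_zero M (\<xi> i)"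
    and "countable F" and s: "s \<in> sign_vectors {1..n}"
  shows "(\<integral>\<^sup>+\<omega>. unif_norm F (\<lambda>f. \<Sum>i=1..n. \<xi> i \<omega> * f (x i)) \<partial>M)
    \<le> 2 * (\<integral>\<^sup>+\<omega>. unif_norm F (\<lambda>f. \<Sum>i=1..n. s i * (\<xi> i \<omega> * f (x i))) \<partial>M)"
  by (rule desymmetrization[OF assms(1) ind _ \<open>countable F\<close>, where h = "\<lambda>f i y. y * f (x i)"])
    (use zero sign_vectorsD[OF s] in \<open>auto simp: mean_zero_def\<close>)

section \<open>Exchangeable samples\<close>

lemma iid_imp_permutation_invariant:
  assumes "prob_space M" and "n \<ge> 1" and iid: "iid_with_law M S n X P"
  shows "permutation_invariant M S n X"
  unfolding permutation_invariant_def
proof (intro allI impI)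
  fix p assume p: "p permutes {1..n}"
  interpret prob_space M by fact
  have ind: "indep_vars (\<lambda>_. S) X {1..n}" and law: "\<And>i. i \<in> {1..n} \<Longrightarrow> distr M S (X i) = P"
    using iid by (auto simp: iid_with_law_def)
  have X: "X i \<in> measurable M S" if "i \<in> {1..n}" for i
    using ind that by (auto simp: indep_vars_def)
  have P: "prob_space P" "sets P = sets S"
    using \<open>n \<ge> 1\<close> law[of 1] X[of 1] prob_space_distr[of "X 1" S] by auto
  have vs: "sets (vec_space n P) = sets (vec_space n S)"
    by (rule sets_PiM_cong) (simp_all add: P)
  have pI: "p i \<in> {1..n}" if "i \<in> {1..n}" for i
    using permutes_in_image[OF p] that by simp
  have joint: "distr M (vec_space n S) (rand_vec n X) = vec_space n P"
    using ind \<open>n \<ge> 1\<close> X law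
    by (subst (asm) indep_vars_iff_distr_eq_PiM') (auto simp: rand_vec_def[abs_def] intro: PiM_cong)
  have g: "(\<lambda>x. \<lambda>i\<in>{1..n}. x (p i)) \<in> measurable (vec_space n S) (vec_space n S)"
    using pI by (intro measurable_restrict measurable_component_singleton) auto
  have RX: "rand_vec n X \<in> measurable M (vec_space n S)"
    unfolding rand_vec_def[abs_def] using X by (intro measurable_restrict) auto
  have "distr M (vec_space n S) (rand_vec n (\<lambda>i. X (p i)))
      = distr (distr M (vec_space n S) (rand_vec n X)) (vec_space n S) (\<lambda>x. \<lambda>i\<in>{1..n}. x (p i))"
    using pI by (subst distr_distr[OF g RX]) (intro distr_cong, auto simp: rand_vec_def o_def)
  also have "\<dots> = distr (vec_space n P) (vec_space n P) (\<lambda>x. \<lambda>i\<in>{1..n}. x (p i))"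
    unfolding joint by (rule distr_cong[OF refl vs[symmetric] refl])
  also have "\<dots> = vec_space n P"
    using pI permutes_inj_on[OF p] by (intro distr_PiM_reindex) (auto simp: P)
  finally show "distr M (vec_space n S) (rand_vec n (\<lambda>i. X (p i))) = distr M (vec_space n S) (rand_vec n X)"
    by (simp only: joint)
qed

lemma nn_integral_permutation_invariant:
  assumes "permutation_invariant M S n X" and p: "p permutes {1..n}"
    and X: "\<And>i. i \<in> {1..n} \<Longrightarrow> X i \<in> measurable M S"
    and g: "g \<in> borel_measurable (vec_space n S)"
  shows "(\<integral>\<^sup>+\<omega>. g (rand_vec n (\<lambda>i. X (p i)) \<omega>) \<partial>M) = (\<integral>\<^sup>+\<omega>. g (rand_vec n X \<omega>) \<partial>M)"
proof -
  have pI: "p i \<in> {1..n}" if "i \<in> {1..n}" for i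
    using permutes_in_image[OF p] that by simp
  have m: "rand_vec n (\<lambda>i. X (p i)) \<in> measurable M (vec_space n S)"
      "rand_vec n X \<in> measurable M (vec_space n S)"
    unfolding rand_vec_def[abs_def] by (intro measurable_restrict X pI; assumption)+
  have "(\<integral>\<^sup>+\<omega>. g (rand_vec n (\<lambda>i. X (p i)) \<omega>) \<partial>M)
      = (\<integral>\<^sup>+x. g x \<partial>distr M (vec_space n S) (rand_vec n (\<lambda>i. X (p i))))"
    using g by (intro nn_integral_distr[OF m(1), symmetric]) simp
  also have "\<dots> = (\<integral>\<^sup>+x. g x \<partial>distr M (vec_space n S) (rand_vec n X))"
    using assms(1) p by (simp add: permutation_invariant_def)
  also have "\<dots> = (\<integral>\<^sup>+\<omega>. g (rand_vec n X \<omega>) \<partial>M)"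
    using g by (intro nn_integral_distr[OF m(2)]) simp
  finally show ?thesis .
qed

lemma ex_permutes_image_initial_segment:
  assumes "A \<subseteq> {1..n::nat}"
  shows "\<exists>p. p permutes {1..n} \<and> p ` {1..card A} = A"
proof -
  have fin: "finite A" using assms by (rule finite_subset) simp
  have le: "card A \<le> n" using card_mono[OF _ assms] by simp
  obtain f where f: "bij_betw f {1..card A} A"
    using fin by (metis card_atLeastAtMost finite_atLeastAtMost finite_same_card_bij diff_Suc_1)
  have "card ({1..n} - {1..card A}) = card ({1..n} - A)"
    using fin assms le by (simp add: card_Diff_subset)
  then obtain g where g: "bij_betw g ({1..n} - {1..card A}) ({1..n} - A)"
    by (metis finite_same_card_bij finite_Diff finite_atLeastAtMost)
  define p where "p i = (if i \<in> {1..card A} then f i else if i \<in> {1..n} then g i else i)" for i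
  have 1: "bij_betw p {1..card A} A"
    using f by (rule bij_betw_cong[THEN iffD1, rotated]) (simp add: p_def)
  have 2: "bij_betw p ({1..n} - {1..card A}) ({1..n} - A)"
    using g by (rule bij_betw_cong[THEN iffD1, rotated]) (auto simp: p_def)
  have "bij_betw p ({1..card A} \<union> ({1..n} - {1..card A})) (A \<union> ({1..n} - A))"
    by (rule bij_betw_combine[OF 1 2]) auto
  then have "bij_betw p {1..n} {1..n}" using assms le by (simp add: Un_absorb1 Un_Diff_cancel)
  then have "p permutes {1..n}"
    using le by (intro bij_imp_permutes) (auto simp: p_def)
  with 1 show ?thesis by (auto simp: bij_betw_def)
qed

text \<open>A permutation moving \<open>{1..card A}\<close> onto \<open>A\<close> changes neither the law of the sample nor the set
  of sign vectors; hence only the size of \<open>A\<close> matters.\<close>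

lemma sum_sign_vectors_subset_eq_initial_segment:
  fixes F :: "('b \<Rightarrow> real) set"
  assumes "permutation_invariant M S n X"
    and X: "\<And>i. i \<in> {1..n} \<Longrightarrow> X i \<in> measurable M S"
    and "countable F" and F: "F \<subseteq> borel_measurable S" and A: "A \<subseteq> {1..n}"
  shows "(\<Sum>s\<in>sign_vectors {1..n}. \<integral>\<^sup>+\<omega>. unif_norm F (\<lambda>f. \<Sum>i\<in>A. s i * f (X i \<omega>)) \<partial>M)
    = (\<Sum>s\<in>sign_vectors {1..n}. \<integral>\<^sup>+\<omega>. unif_norm F (\<lambda>f. \<Sum>i=1..card A. s i * f (X i \<omega>)) \<partial>M)"
proof -
  obtain p where p: "p permutes {1..n}" and pA: "p ` {1..card A} = A"
    using ex_permutes_image_initial_segment[OF A] by blast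
  have le: "card A \<le> n" using card_mono[OF _ A] by simp
  have "(\<integral>\<^sup>+\<omega>. unif_norm F (\<lambda>f. \<Sum>i\<in>A. s i * f (X i \<omega>)) \<partial>M)
      = (\<integral>\<^sup>+\<omega>. unif_norm F (\<lambda>f. \<Sum>j=1..card A. (\<lambda>i\<in>{1..n}. s (p i)) j * f (X j \<omega>)) \<partial>M)" for s
  proof -
    define g where "g x = unif_norm F (\<lambda>f. \<Sum>j=1..card A. s (p j) * f (x j))" for x
    have "g \<in> borel_measurable (vec_space n S)"
      unfolding g_def[abs_def]
    proof (intro borel_measurable_unif_norm \<open>countable F\<close> borel_measurable_sum)
      fix f i assume "f \<in> F" and "i \<in> {1..card A}"
      then have [measurable]: "f \<in> borel_measurable S" and "i \<in> {1..n}" using F le by auto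
      then show "(\<lambda>x. s (p i) * f (x i)) \<in> borel_measurable (vec_space n S)" by measurable
    qed
    note perm = nn_integral_permutation_invariant[OF assms(1) p X this]
    have "(\<Sum>i\<in>A. s i * f (X i \<omega>)) = (\<Sum>j=1..card A. s (p j) * f (X (p j) \<omega>))" for f \<omega>
      using sum.reindex[OF permutes_inj_on[OF p], of "\<lambda>i. s i * f (X i \<omega>)" "{1..card A}"]
      unfolding pA by simp
    then have "(\<integral>\<^sup>+\<omega>. unif_norm F (\<lambda>f. \<Sum>i\<in>A. s i * f (X i \<omega>)) \<partial>M)
        = (\<integral>\<^sup>+\<omega>. g (rand_vec n (\<lambda>i. X (p i)) \<omega>) \<partial>M)"
      using le by (simp add: g_def rand_vec_def)
    also have "\<dots> = (\<integral>\<^sup>+\<omega>. g (rand_vec n X \<omega>) \<partial>M)" by (rule perm)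
    finally show ?thesis using le by (simp add: g_def rand_vec_def)
  qed
  then show ?thesis
    by (simp only: sum_sign_vectors_permute[OF p,
      of "\<lambda>s. \<integral>\<^sup>+\<omega>. unif_norm F (\<lambda>f. \<Sum>j=1..card A. s j * f (X j \<omega>)) \<partial>M"])
qed

lemma expected_sup_decouple:
  fixes F :: "('b \<Rightarrow> real) set"
  assumes "prob_space M" and "k \<le> n"
    and ind: "indep_rvs M (vec_space n borel) (rand_vec n c) (vec_space n S) (rand_vec n X)"
    and "countable F" and F: "F \<subseteq> borel_measurable S"
  shows "expected_sup M k c X F
    = (\<integral>\<^sup>+\<omega>. (\<integral>\<^sup>+\<omega>'. unif_norm F (\<lambda>f. \<Sum>i=1..k. c i \<omega> * f (X i \<omega>')) \<partial>M) \<partial>M)"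
proof -
  define g :: "(nat \<Rightarrow> real) \<times> (nat \<Rightarrow> 'b) \<Rightarrow> ennreal"
    where "g p = unif_norm F (\<lambda>f. \<Sum>i=1..k. fst p i * f (snd p i))" for p
  have "g \<in> borel_measurable (vec_space n borel \<Otimes>\<^sub>M vec_space n S)"
    unfolding g_def[abs_def]
  proof (intro borel_measurable_unif_norm \<open>countable F\<close> borel_measurable_sum)
    fix f i assume "f \<in> F" and "i \<in> {1..k}"
    then have [measurable]: "f \<in> borel_measurable S" and "i \<in> {1..n}" using F \<open>k \<le> n\<close> by auto
    then show "(\<lambda>p. fst p i * f (snd p i)) \<in> borel_measurable (vec_space n borel \<Otimes>\<^sub>M vec_space n S)"
      by measurable
  qed
  from nn_integral_decouple[OF \<open>prob_space M\<close> ind this] show ?thesis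
    using \<open>k \<le> n\<close> by (simp add: expected_sup_def g_def rand_vec_def)
qed

text \<open>This turns the assumed bounds for initial segments into bounds for arbitrary index sets, which
  is the form needed for the exceedance sets \<open>{i. \<bar>\<xi> i\<bar> > t}\<close>.\<close>

lemma sum_sign_vectors_subset_le:
  fixes F :: "nat \<Rightarrow> ('b \<Rightarrow> real) set" and \<psi> :: "real \<Rightarrow> real"
  assumes "prob_space M" and "n \<ge> 1"
    and "permutation_invariant M S n X"
    and ind: "prob_space.indep_vars M (\<lambda>_. borel) \<epsilon> {1..n}"
    and rad: "\<And>i. i \<in> {1..n} \<Longrightarrow> rademacher M (\<epsilon> i)"
    and \<epsilon>X: "indep_rvs M (vec_space n borel) (rand_vec n \<epsilon>) (vec_space n S) (rand_vec n X)"
    and F: "\<And>k. k \<in> {1..n} \<Longrightarrow> countable (F k) \<and> F k \<subseteq> borel_measurable S \<and> F n \<subseteq> F k"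
    and bound: "\<And>k. k \<in> {1..n} \<Longrightarrow> expected_sup M k \<epsilon> X (F k) \<le> ennreal (\<psi> (real k))"
    and A: "A \<subseteq> {1..n}"
  shows "(\<Sum>s\<in>sign_vectors {1..n}. \<integral>\<^sup>+\<omega>. unif_norm (F n) (\<lambda>f. \<Sum>i\<in>A. s i * f (X i \<omega>)) \<partial>M)
    \<le> 2 ^ n * ennreal (\<psi> (real (card A)))"
proof (cases "A = {}")
  case True
  have "unif_norm (F n) (\<lambda>f. 0) = 0"
    by (cases "F n = {}") (simp_all add: bot_ennreal)
  with True show ?thesis by simp
next
  case False
  let ?k = "card A"
  have k: "?k \<in> {1..n}"
    using False card_mono[OF _ A] finite_subset[OF A] by (simp add: Suc_le_eq card_gt_0_iff)
  have n: "n \<in> {1..n}" using \<open>n \<ge> 1\<close> by simp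
  define \<Phi> where "\<Phi> s = (\<integral>\<^sup>+\<omega>. unif_norm (F n) (\<lambda>f. \<Sum>i=1..?k. s i * f (X i \<omega>)) \<partial>M)" for s
  have "(\<Sum>s\<in>sign_vectors {1..n}. \<integral>\<^sup>+\<omega>. unif_norm (F n) (\<lambda>f. \<Sum>i\<in>A. s i * f (X i \<omega>)) \<partial>M)
      = (\<Sum>s\<in>sign_vectors {1..n}. \<Phi> s)"
    unfolding \<Phi>_def using F[OF n]
    by (intro sum_sign_vectors_subset_eq_initial_segment[OF assms(3) _ _ _ A])
      (auto intro: indep_rvs_rand_vecD[OF \<epsilon>X])
  also have "\<dots> \<le> 2 ^ n * (\<integral>\<^sup>+\<omega>. \<Phi> (rand_vec n \<epsilon> \<omega>) \<partial>M)"
    using assms(1,2) ind rad by (rule sum_sign_vectors_le_rademacher_average)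
  also have "(\<integral>\<^sup>+\<omega>. \<Phi> (rand_vec n \<epsilon> \<omega>) \<partial>M) = expected_sup M ?k \<epsilon> X (F n)"
    using F[OF n] k by (subst expected_sup_decouple[OF assms(1) _ \<epsilon>X]) (auto simp: \<Phi>_def rand_vec_def)
  also have "\<dots> \<le> expected_sup M ?k \<epsilon> X (F ?k)"
    unfolding expected_sup_def using F[OF k] by (intro nn_integral_mono SUP_subset_mono) auto
  also have "\<dots> \<le> ennreal (\<psi> (real ?k))" using k by (rule bound)
  finally show ?thesis by (simp add: mult_left_mono)
qed

section \<open>Layer cake representation of the multipliers\<close>

text \<open>Write \<open>\<bar>c i\<bar>\<close> as the Lebesgue measure of \<open>{0..<\<bar>c i\<bar>}\<close>: the weighted sum is the integral
  over \<open>t\<close> of the unweighted sums over the indices with \<open>\<bar>c i\<bar> > t\<close>, and the norm of an integral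
  is at most the integral of the norm.\<close>

lemma unif_norm_layer_cake:
  fixes a :: "'f \<Rightarrow> 'i \<Rightarrow> real" and c :: "'i \<Rightarrow> real"
  assumes "finite I"
  shows "unif_norm F (\<lambda>f. \<Sum>i\<in>I. a f i * \<bar>c i\<bar>)
    \<le> (\<integral>\<^sup>+t\<in>{0..}. unif_norm F (\<lambda>f. \<Sum>i\<in>{i\<in>I. \<bar>c i\<bar> > t}. a f i) \<partial>lborel)"
proof (rule SUP_least)
  fix f assume "f \<in> F"
  have int: "has_bochner_integral lborel (\<lambda>t. a f i * indicator {0..<\<bar>c i\<bar>} t) (a f i * \<bar>c i\<bar>)" for i
    using has_bochner_integral_real_indicator[of "{0..<\<bar>c i\<bar>}" lborel] 
    by (intro has_bochner_integral_mult_right) auto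
  have "has_bochner_integral lborel (\<lambda>t. \<Sum>i\<in>I. a f i * indicator {0..<\<bar>c i\<bar>} t) (\<Sum>i\<in>I. a f i * \<bar>c i\<bar>)"
    by (intro has_bochner_integral_sum int)
  then have "ennreal \<bar>\<Sum>i\<in>I. a f i * \<bar>c i\<bar>\<bar>
      \<le> (\<integral>\<^sup>+t. ennreal \<bar>\<Sum>i\<in>I. a f i * indicator {0..<\<bar>c i\<bar>} t\<bar> \<partial>lborel)"
    using integral_norm_bound_ennreal[of lborel "\<lambda>t. \<Sum>i\<in>I. a f i * indicator {0..<\<bar>c i\<bar>} t"]
    by (simp add: has_bochner_integral_iff)
  also have "\<dots> \<le> (\<integral>\<^sup>+t\<in>{0..}. unif_norm F (\<lambda>f. \<Sum>i\<in>{i\<in>I. \<bar>c i\<bar> > t}. a f i) \<partial>lborel)"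
  proof (rule nn_integral_mono)
    fix t :: real
    show "ennreal \<bar>\<Sum>i\<in>I. a f i * indicator {0..<\<bar>c i\<bar>} t\<bar>
        \<le> unif_norm F (\<lambda>f. \<Sum>i\<in>{i\<in>I. \<bar>c i\<bar> > t}. a f i) * indicator {0..} t"
    proof (cases "t \<ge> 0")
      case True
      have "(\<Sum>i\<in>I. a f i * indicator {0..<\<bar>c i\<bar>} t) = (\<Sum>i\<in>{i\<in>I. \<bar>c i\<bar> > t}. a f i)"
        using True \<open>finite I\<close> by (auto simp: indicator_def intro!: sum.mono_neutral_cong_right)
      then show ?thesis using True \<open>f \<in> F\<close> by (auto intro: SUP_upper)
    qed (simp add: indicator_def)
  qed
  finally show "ennreal \<bar>\<Sum>i\<in>I. a f i * \<bar>c i\<bar>\<bar>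
    \<le> (\<integral>\<^sup>+t\<in>{0..}. unif_norm F (\<lambda>f. \<Sum>i\<in>{i\<in>I. \<bar>c i\<bar> > t}. a f i) \<partial>lborel)" .
qed

text \<open>After averaging over all sign vectors the signs of the weights \<open>c i\<close> disappear, so the layer
  cake bound applies with \<open>\<bar>c i\<bar>\<close> and produces unweighted signed sums over exceedance sets, for
  which a bound in terms of the cardinality is assumed.\<close>

lemma sum_sign_vectors_unif_norm_le_layers:
  fixes v :: "'f \<Rightarrow> 'i \<Rightarrow> 'a \<Rightarrow> real" and c :: "'i \<Rightarrow> real" and C :: "nat \<Rightarrow> ennreal"
  assumes "prob_space M" and "finite I" and "countable F"
    and v: "\<And>f i. f \<in> F \<Longrightarrow> i \<in> I \<Longrightarrow> v f i \<in> borel_measurable M"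
    and C: "\<And>A. A \<subseteq> I \<Longrightarrow>
      (\<Sum>s\<in>sign_vectors I. \<integral>\<^sup>+\<omega>. unif_norm F (\<lambda>f. \<Sum>i\<in>A. s i * v f i \<omega>) \<partial>M) \<le> C (card A)"
  shows "(\<Sum>s\<in>sign_vectors I. \<integral>\<^sup>+\<omega>. unif_norm F (\<lambda>f. \<Sum>i\<in>I. s i * (c i * v f i \<omega>)) \<partial>M)
    \<le> (\<integral>\<^sup>+t\<in>{0..}. C (card {i\<in>I. \<bar>c i\<bar> > t}) \<partial>lborel)"
proof -
  interpret prob_space M by fact
  interpret pair_sigma_finite M "lborel :: real measure" ..
  \<comment> \<open>The sign of \<open>c i\<close>, with value \<open>1\<close> at \<open>0\<close> so that multiplying by it maps sign vectors to sign vectors.\<close>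
  define \<sigma> :: "'i \<Rightarrow> real" where "\<sigma> i = (if c i < 0 then -1 else 1)" for i
  define L where "L t = {i\<in>I. \<bar>c i\<bar> > t}" for t
  define U where "U s t \<omega> = unif_norm F (\<lambda>f. \<Sum>i\<in>L t. s i * \<sigma> i * v f i \<omega>)" for s t \<omega>
  have c: "c i = \<sigma> i * \<bar>c i\<bar>" for i by (simp add: \<sigma>_def)
  have U_meas: "(\<lambda>(\<omega>, t). U s t \<omega> * indicator {0..} t) \<in> borel_measurable (M \<Otimes>\<^sub>M lborel)" for s
  proof -
    have "U s t \<omega> = unif_norm F (\<lambda>f. \<Sum>i\<in>I. if \<bar>c i\<bar> > t then s i * \<sigma> i * v f i \<omega> else 0)" for t \<omega>
      using \<open>finite I\<close> by (simp add: U_def L_def sum.inter_filter)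
    moreover have "(\<lambda>p. unif_norm F (\<lambda>f. \<Sum>i\<in>I. if \<bar>c i\<bar> > snd p then s i * \<sigma> i * v f i (fst p) else 0))
        \<in> borel_measurable (M \<Otimes>\<^sub>M lborel)"
    proof (intro borel_measurable_unif_norm \<open>countable F\<close> borel_measurable_sum)
      fix f i assume "f \<in> F" "i \<in> I"
      then have [measurable]: "v f i \<in> borel_measurable M" by (rule v)
      show "(\<lambda>p. if \<bar>c i\<bar> > snd p then s i * \<sigma> i * v f i (fst p) else 0) \<in> borel_measurable (M \<Otimes>\<^sub>M lborel)"
        by measurable
    qed
    ultimately have [measurable]: "(\<lambda>p. U s (snd p) (fst p)) \<in> borel_measurable (M \<Otimes>\<^sub>M lborel)" by simp
    show ?thesis unfolding case_prod_beta by measurable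
  qed
  have "(\<Sum>s\<in>sign_vectors I. \<integral>\<^sup>+\<omega>. unif_norm F (\<lambda>f. \<Sum>i\<in>I. s i * (c i * v f i \<omega>)) \<partial>M)
      \<le> (\<Sum>s\<in>sign_vectors I. \<integral>\<^sup>+\<omega>. (\<integral>\<^sup>+t\<in>{0..}. U s t \<omega> \<partial>lborel) \<partial>M)"
  proof (intro sum_mono nn_integral_mono)
    fix s \<omega>
    have "(\<Sum>i\<in>I. s i * (c i * v f i \<omega>)) = (\<Sum>i\<in>I. s i * \<sigma> i * v f i \<omega> * \<bar>c i\<bar>)" for f
      by (intro sum.cong refl) (subst c, simp only: mult_ac)
    then show "unif_norm F (\<lambda>f. \<Sum>i\<in>I. s i * (c i * v f i \<omega>)) \<le> (\<integral>\<^sup>+t\<in>{0..}. U s t \<omega> \<partial>lborel)"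
      using unif_norm_layer_cake[OF \<open>finite I\<close>, of "\<lambda>f i. s i * \<sigma> i * v f i \<omega>" c F]
      by (simp add: U_def L_def)
  qed
  also have "\<dots> = (\<Sum>s\<in>sign_vectors I. \<integral>\<^sup>+t. (\<integral>\<^sup>+\<omega>. U s t \<omega> * indicator {0..} t \<partial>M) \<partial>lborel)"
    using Fubini'[OF U_meas] by simp
  also have "\<dots> = (\<integral>\<^sup>+t. (\<Sum>s\<in>sign_vectors I. \<integral>\<^sup>+\<omega>. U s t \<omega> * indicator {0..} t \<partial>M) \<partial>lborel)"
  proof (rule nn_integral_sum[symmetric])
    fix s
    have [measurable]: "(\<lambda>(t, \<omega>). U s t \<omega> * indicator {0..} t) \<in> borel_measurable (lborel \<Otimes>\<^sub>M M)"
      using measurable_pair_swap[OF U_meas[of s]] by simp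
    show "(\<lambda>t. \<integral>\<^sup>+\<omega>. U s t \<omega> * indicator {0..} t \<partial>M) \<in> borel_measurable lborel"
      by measurable
  qed
  also have "\<dots> \<le> (\<integral>\<^sup>+t\<in>{0..}. C (card (L t)) \<partial>lborel)"
  proof (rule nn_integral_mono)
    fix t :: real
    have "(\<Sum>s\<in>sign_vectors I. \<integral>\<^sup>+\<omega>. U s t \<omega> \<partial>M)
        = (\<Sum>s\<in>sign_vectors I. \<integral>\<^sup>+\<omega>. unif_norm F (\<lambda>f. \<Sum>i\<in>L t. (\<lambda>i\<in>I. s i * \<sigma> i) i * v f i \<omega>) \<partial>M)"
      by (simp add: U_def L_def)
    also have "\<dots> = (\<Sum>s\<in>sign_vectors I. \<integral>\<^sup>+\<omega>. unif_norm F (\<lambda>f. \<Sum>i\<in>L t. s i * v f i \<omega>) \<partial>M)"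
      by (rule sum_sign_vectors_flip) (simp add: \<sigma>_def)
    also have "\<dots> \<le> C (card (L t))"
      by (rule C) (auto simp: L_def)
    finally show "(\<Sum>s\<in>sign_vectors I. \<integral>\<^sup>+\<omega>. U s t \<omega> * indicator {0..} t \<partial>M)
        \<le> C (card (L t)) * indicator {0..} t"
      by (cases "t \<ge> 0") auto
  qed
  finally show ?thesis by (simp add: L_def)
qed

section \<open>Jensen's inequality for the number of exceedances\<close>

text \<open>The number of events that occur takes only finitely many values and has mean the sum of the
  probabilities. Jensen's inequality is therefore a finite convex combination, which also covers a
  concave function that jumps at \<open>0\<close>.\<close>

lemma nn_integral_concave_card_le:
  fixes \<psi> :: "real \<Rightarrow> real"
  assumes "prob_space M" and "finite I" and A: "\<And>i. i \<in> I \<Longrightarrow> A i \<in> sets M"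
    and conc: "concave_on {0..} \<psi>" and nonneg: "\<And>x. x \<ge> 0 \<Longrightarrow> \<psi> x \<ge> 0"
  shows "(\<integral>\<^sup>+\<omega>. ennreal (\<psi> (real (card {i\<in>I. \<omega> \<in> A i}))) \<partial>M)
    \<le> ennreal (\<psi> (\<Sum>i\<in>I. measure M (A i)))"
proof -
  interpret prob_space M by fact
  define K where "K \<omega> = card {i\<in>I. \<omega> \<in> A i}" for \<omega>
  have K_sum: "K \<omega> = (\<Sum>i\<in>I. indicator (A i) \<omega>)" for \<omega>
    using \<open>finite I\<close> by (simp add: K_def indicator_def sum.If_cases Int_def)
  have [measurable]: "K \<in> measurable M (count_space UNIV)"
    unfolding K_sum[abs_def]
  proof (intro measurable_sum_nat)
    fix i assume "i \<in> I"
    then have [measurable]: "A i \<in> sets M" by (rule A)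
    show "(\<lambda>\<omega>. indicator (A i) \<omega> :: nat) \<in> measurable M (count_space UNIV)"
      unfolding indicator_def of_bool_def by measurable
  qed
  define w where "w k = prob {\<omega>\<in>space M. K \<omega> = k}" for k
  have K_le: "K \<omega> \<le> card I" for \<omega>
    unfolding K_def using \<open>finite I\<close> by (intro card_mono) auto
  \<comment> \<open>Used for \<open>\<phi> = 1\<close> (total mass), the identity (mean) and \<open>\<psi>\<close>.\<close>
  have law: "(\<integral>\<^sup>+\<omega>. ennreal (\<phi> (K \<omega>)) \<partial>M) = ennreal (\<Sum>k\<le>card I. w k * \<phi> k)"
    if "\<And>k. \<phi> k \<ge> 0" for \<phi> :: "nat \<Rightarrow> real"
  proof -
    have "(\<integral>\<^sup>+\<omega>. ennreal (\<phi> (K \<omega>)) \<partial>M)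
        = (\<integral>\<^sup>+\<omega>. (\<Sum>k\<le>card I. ennreal (\<phi> k) * indicator {\<omega>\<in>space M. K \<omega> = k} \<omega>) \<partial>M)"
    proof (rule nn_integral_cong)
      fix \<omega> assume \<omega>: "\<omega> \<in> space M"
      have "(\<Sum>k\<le>card I. ennreal (\<phi> k) * indicator {\<omega>\<in>space M. K \<omega> = k} \<omega>)
          = (\<Sum>k\<le>card I. if k = K \<omega> then ennreal (\<phi> (K \<omega>)) else 0)"
        using \<omega> by (intro sum.cong) (auto simp: indicator_def)
      then show "ennreal (\<phi> (K \<omega>)) = (\<Sum>k\<le>card I. ennreal (\<phi> k) * indicator {\<omega>\<in>space M. K \<omega> = k} \<omega>)"
        using K_le by simp
    qed
    also have "\<dots> = (\<Sum>k\<le>card I. ennreal (\<phi> k) * emeasure M {\<omega>\<in>space M. K \<omega> = k})"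
      by (subst nn_integral_sum) (simp_all add: nn_integral_cmult_indicator)
    also have "\<dots> = (\<Sum>k\<le>card I. ennreal (w k * \<phi> k))"
      using that by (simp add: emeasure_eq_measure w_def ennreal_mult mult.commute)
    also have "\<dots> = ennreal (\<Sum>k\<le>card I. w k * \<phi> k)"
      using that by (intro sum_ennreal) (simp add: w_def)
    finally show ?thesis .
  qed
  have w_nonneg: "w k \<ge> 0" for k by (simp add: w_def)
  have total: "(\<Sum>k\<le>card I. w k) = 1"
    using law[of "\<lambda>_. 1"] w_nonneg by (simp add: emeasure_space_1 sum_nonneg)
  have "ennreal (\<Sum>k\<le>card I. w k * real k) = (\<integral>\<^sup>+\<omega>. (\<Sum>i\<in>I. indicator (A i) \<omega>) \<partial>M)"
    by (subst law[symmetric]) (auto simp: K_sum indicator_def intro!: nn_integral_cong sum.cong simp flip: sum_ennreal)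
  also have "\<dots> = ennreal (\<Sum>i\<in>I. prob (A i))"
    using A by (simp add: nn_integral_sum emeasure_eq_measure sum_ennreal)
  finally have mean: "(\<Sum>k\<le>card I. w k * real k) = (\<Sum>i\<in>I. prob (A i))"
    by (subst (asm) ennreal_inj) (auto intro: sum_nonneg simp: w_nonneg)
  have "(\<integral>\<^sup>+\<omega>. ennreal (\<psi> (real (K \<omega>))) \<partial>M) = ennreal (\<Sum>k\<le>card I. w k * \<psi> (real k))"
    by (rule law) (simp add: nonneg)
  also have "\<dots> \<le> ennreal (\<psi> (\<Sum>k\<le>card I. w k *\<^sub>R real k))"
    by (intro ennreal_leI concave_on_sum[OF _ _ conc]) (auto simp: total w_nonneg)
  finally show ?thesis by (simp add: K_def mean)
qed

lemma borel_measurable_card_exceedances: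
  fixes \<phi> :: "nat \<Rightarrow> ennreal" and \<xi> :: "'i \<Rightarrow> 'a \<Rightarrow> real"
  assumes "finite I" and \<xi>: "\<And>i. i \<in> I \<Longrightarrow> \<xi> i \<in> borel_measurable M"
  shows "(\<lambda>(\<omega>, t). \<phi> (card {i\<in>I. \<bar>\<xi> i \<omega>\<bar> > t})) \<in> borel_measurable (M \<Otimes>\<^sub>M lborel)"
proof -
  have "(\<lambda>p. \<Sum>i\<in>I. if \<bar>\<xi> i (fst p)\<bar> > snd p then 1 else 0 :: nat) \<in> measurable (M \<Otimes>\<^sub>M lborel) (count_space UNIV)"
  proof (intro measurable_sum_nat)
    fix i assume "i \<in> I"
    then have [measurable]: "\<xi> i \<in> borel_measurable M" by (rule \<xi>)
    show "(\<lambda>p. if \<bar>\<xi> i (fst p)\<bar> > snd p then 1 else 0 :: nat) \<in> measurable (M \<Otimes>\<^sub>M lborel) (count_space UNIV)"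
      by measurable
  qed
  from measurable_compose[OF this, of \<phi> borel] show ?thesis
    using \<open>finite I\<close> by (simp add: sum.If_cases Int_def case_prod_beta)
qed

lemma nn_integral_layers_le:
  fixes \<psi> :: "real \<Rightarrow> real" and \<xi> :: "'i \<Rightarrow> 'a \<Rightarrow> real"
  assumes "prob_space M" and "finite I" and \<xi>: "\<And>i. i \<in> I \<Longrightarrow> \<xi> i \<in> borel_measurable M"
    and "concave_on {0..} \<psi>" and "\<And>x. x \<ge> 0 \<Longrightarrow> \<psi> x \<ge> 0"
  shows "(\<integral>\<^sup>+\<omega>. (\<integral>\<^sup>+t\<in>{0..}. ennreal (\<psi> (real (card {i\<in>I. \<bar>\<xi> i \<omega>\<bar> > t}))) \<partial>lborel) \<partial>M)
    \<le> (\<integral>\<^sup>+t\<in>{0..}. ennreal (\<psi> (\<Sum>i\<in>I. measure M {\<omega>\<in>space M. \<bar>\<xi> i \<omega>\<bar> > t})) \<partial>lborel)"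
proof -
  interpret prob_space M by fact
  interpret pair_sigma_finite M "lborel :: real measure" ..
  define K where "K \<omega> t = card {i\<in>I. \<bar>\<xi> i \<omega>\<bar> > t}" for \<omega> t
  have [measurable]: "(\<lambda>(\<omega>, t). ennreal (\<psi> (real (K \<omega> t)))) \<in> borel_measurable (M \<Otimes>\<^sub>M lborel)"
    unfolding K_def using \<open>finite I\<close> \<xi> by (rule borel_measurable_card_exceedances)
  have "(\<integral>\<^sup>+\<omega>. (\<integral>\<^sup>+t\<in>{0..}. ennreal (\<psi> (real (K \<omega> t))) \<partial>lborel) \<partial>M)
      = (\<integral>\<^sup>+t. (\<integral>\<^sup>+\<omega>. ennreal (\<psi> (real (K \<omega> t))) * indicator {0..} t \<partial>M) \<partial>lborel)"
    by (rule Fubini'[symmetric]) measurable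
  also have "\<dots> \<le> (\<integral>\<^sup>+t\<in>{0..}. ennreal (\<psi> (\<Sum>i\<in>I. prob {\<omega>\<in>space M. \<bar>\<xi> i \<omega>\<bar> > t})) \<partial>lborel)"
  proof (rule nn_integral_mono)
    fix t :: real
    have "(\<integral>\<^sup>+\<omega>. ennreal (\<psi> (real (K \<omega> t))) \<partial>M)
        = (\<integral>\<^sup>+\<omega>. ennreal (\<psi> (real (card {i\<in>I. \<omega> \<in> {\<omega>\<in>space M. \<bar>\<xi> i \<omega>\<bar> > t}}))) \<partial>M)"
      by (intro nn_integral_cong) (simp add: K_def)
    also have "\<dots> \<le> ennreal (\<psi> (\<Sum>i\<in>I. prob {\<omega>\<in>space M. \<bar>\<xi> i \<omega>\<bar> > t}))"
    proof (rule nn_integral_concave_card_le)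
      fix i assume "i \<in> I"
      then have [measurable]: "\<xi> i \<in> borel_measurable M" by (rule \<xi>)
      show "{\<omega>\<in>space M. \<bar>\<xi> i \<omega>\<bar> > t} \<in> events" by measurable
    qed (use assms in auto)
    finally show "(\<integral>\<^sup>+\<omega>. ennreal (\<psi> (real (K \<omega> t))) * indicator {0..} t \<partial>M)
        \<le> ennreal (\<psi> (\<Sum>i\<in>I. prob {\<omega>\<in>space M. \<bar>\<xi> i \<omega>\<bar> > t})) * indicator {0..} t"
      by (cases "t \<ge> 0") auto
  qed
  finally show ?thesis by (simp add: K_def)
qed

section \<open>The multiplier inequality\<close>

theorem theorem1:
  fixes M :: "'a measure" and S P :: "'b measure"
    and n :: nat
    and \<xi> \<epsilon> :: "nat \<Rightarrow> 'a \<Rightarrow> real" and X :: "nat \<Rightarrow> 'a \<Rightarrow> 'b"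
    and F :: "nat \<Rightarrow> ('b \<Rightarrow> real) set"
    and \<psi> :: "real \<Rightarrow> real"
  assumes "prob_space M" and "n \<ge> 1"
    and "indep_rvs M (vec_space n borel) (rand_vec n \<xi>) (vec_space n S) (rand_vec n X)"
    and "prob_space.indep_vars M (\<lambda>_. borel) \<epsilon> {1..n}"
    and "\<forall>i\<in>{1..n}. rademacher M (\<epsilon> i)"
    and "indep_rvs M (vec_space n borel) (rand_vec n \<epsilon>)
           (vec_space n borel \<Otimes>\<^sub>M vec_space n S) (\<lambda>\<omega>. (rand_vec n \<xi> \<omega>, rand_vec n X \<omega>))"
    and "\<forall>k\<in>{1..n}. countable (F k) \<and> F k \<subseteq> borel_measurable S \<and> F n \<subseteq> F k"
    and "(iid_with_law M S n X P \<and> centered_class P (F n)) \<or>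
         (permutation_invariant M S n X \<and>
          prob_space.indep_vars M (\<lambda>_. borel) \<xi> {1..n} \<and> (\<forall>i\<in>{1..n}. mean_zero M (\<xi> i)))"
    and "mono_on {0..} \<psi>" and "concave_on {0..} \<psi>"
    and "\<forall>x\<ge>0. \<psi> x \<ge> 0" and "\<psi> 0 = 0"
    and "\<forall>k\<in>{1..n}. expected_sup M k \<epsilon> X (F k) \<le> ennreal (\<psi> (real k))"
  shows "expected_sup M n \<xi> X (F n)
    \<le> 4 * (\<integral>\<^sup>+t\<in>{0..}. ennreal (\<psi> (\<Sum>i=1..n. measure M {\<omega> \<in> space M. \<bar>\<xi> i \<omega>\<bar> > t})) \<partial>lborel)"
proof -
  interpret prob_space M by fact
  interpret pair_sigma_finite M M ..
  let ?E = "expected_sup M n \<xi> X (F n)" and ?S = "sign_vectors {1..n}"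
    and ?J = "\<integral>\<^sup>+t\<in>{0..}. ennreal (\<psi> (\<Sum>i=1..n. measure M {\<omega> \<in> space M. \<bar>\<xi> i \<omega>\<bar> > t})) \<partial>lborel"
  have n: "n \<in> {1..n}" using \<open>n \<ge> 1\<close> by simp
  have Fn: "countable (F n)" "F n \<subseteq> borel_measurable S" using assms(7) n by auto
  have \<xi>: "\<xi> i \<in> borel_measurable M" and X: "X i \<in> measurable M S" if "i \<in> {1..n}" for i
    using indep_rvs_rand_vecD[OF assms(3) that] by auto
  have \<epsilon>X: "indep_rvs M (vec_space n borel) (rand_vec n \<epsilon>) (vec_space n S) (rand_vec n X)"
    using indep_rvs_compose[OF assms(1,6) measurable_snd] by simp
  have perm: "permutation_invariant M S n X"
    using assms(8) iid_imp_permutation_invariant[OF assms(1,2)] by blast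
  \<comment> \<open>The multipliers live on the first copy of the probability space and the sample on the second;
    the constant vector \<open>1\<close> gives the sum without signs.\<close>
  define V where "V s \<omega> \<omega>' = unif_norm (F n) (\<lambda>f. \<Sum>i=1..n. s i * (\<xi> i \<omega> * f (X i \<omega>')))" for s \<omega> \<omega>'
  have V_meas: "case_prod (V s) \<in> borel_measurable (M \<Otimes>\<^sub>M M)" for s
    unfolding V_def[abs_def] case_prod_beta
  proof (intro borel_measurable_unif_norm Fn borel_measurable_sum)
    fix f i assume "f \<in> F n" and i: "i \<in> {1..n}"
    then have [measurable]: "f \<in> borel_measurable S" using Fn by auto
    note [measurable] = \<xi>[OF i] X[OF i]
    show "(\<lambda>p. s i * (\<xi> i (fst p) * f (X i (snd p)))) \<in> borel_measurable (M \<Otimes>\<^sub>M M)" by measurable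
  qed
  have V_fst: "(\<lambda>\<omega>. \<integral>\<^sup>+\<omega>'. V s \<omega> \<omega>' \<partial>M) \<in> borel_measurable M" for s
    using sigma_finite_measure.borel_measurable_nn_integral_fst[OF prob_space_imp_sigma_finite[OF assms(1)] V_meas[of s]] by simp
  have V_snd: "(\<lambda>\<omega>'. \<integral>\<^sup>+\<omega>. V s \<omega> \<omega>' \<partial>M) \<in> borel_measurable M" for s
    using sigma_finite_measure.borel_measurable_nn_integral_fst[OF prob_space_imp_sigma_finite[OF assms(1)] measurable_pair_swap[OF V_meas[of s]]] by simp
  have V1: "V (\<lambda>_. 1) \<omega> \<omega>' = unif_norm (F n) (\<lambda>f. \<Sum>i=1..n. \<xi> i \<omega> * f (X i \<omega>'))" for \<omega> \<omega>'
    by (simp add: V_def)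
  have E: "?E = (\<integral>\<^sup>+\<omega>. (\<integral>\<^sup>+\<omega>'. V (\<lambda>_. 1) \<omega> \<omega>' \<partial>M) \<partial>M)"
    unfolding V1 by (rule expected_sup_decouple[OF assms(1) _ assms(3) Fn]) simp
  have randomize: "?E \<le> 2 * (\<integral>\<^sup>+\<omega>. (\<integral>\<^sup>+\<omega>'. V s \<omega> \<omega>' \<partial>M) \<partial>M)" if s: "s \<in> ?S" for s
    using assms(8)
  proof (elim disjE conjE)
    assume "iid_with_law M S n X P" and "centered_class P (F n)"
    note desymmetrization_iid[OF assms(1) this Fn s]
    then have "?E \<le> (\<integral>\<^sup>+\<omega>. 2 * (\<integral>\<^sup>+\<omega>'. V s \<omega> \<omega>' \<partial>M) \<partial>M)"
      unfolding E V1 by (intro nn_integral_mono) (simp add: V_def)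
    also have "\<dots> = 2 * (\<integral>\<^sup>+\<omega>. (\<integral>\<^sup>+\<omega>'. V s \<omega> \<omega>' \<partial>M) \<partial>M)"
      by (intro nn_integral_cmult V_fst)
    finally show ?thesis .
  next
    assume "indep_vars (\<lambda>_. borel) \<xi> {1..n}" and "\<forall>i\<in>{1..n}. mean_zero M (\<xi> i)"
    note desym = desymmetrization_multipliers[OF assms(1) this(1) bspec[OF this(2)] Fn(1) s]
    \<comment> \<open>Here the multipliers are the random variables, so they have to be integrated first.\<close>
    have "?E = (\<integral>\<^sup>+\<omega>'. (\<integral>\<^sup>+\<omega>. V (\<lambda>_. 1) \<omega> \<omega>' \<partial>M) \<partial>M)"
      unfolding E by (rule Fubini'[OF V_meas, symmetric])
    also have "\<dots> \<le> (\<integral>\<^sup>+\<omega>'. 2 * (\<integral>\<^sup>+\<omega>. V s \<omega> \<omega>' \<partial>M) \<partial>M)"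
      unfolding V1 using desym by (intro nn_integral_mono) (simp add: V_def)
    also have "\<dots> = 2 * (\<integral>\<^sup>+\<omega>'. (\<integral>\<^sup>+\<omega>. V s \<omega> \<omega>' \<partial>M) \<partial>M)"
      by (intro nn_integral_cmult V_snd)
    also have "\<dots> = 2 * (\<integral>\<^sup>+\<omega>. (\<integral>\<^sup>+\<omega>'. V s \<omega> \<omega>' \<partial>M) \<partial>M)"
      by (simp only: Fubini'[OF V_meas])
    finally show ?thesis .
  qed
  define \<Psi> where "\<Psi> \<omega> t = ennreal (\<psi> (real (card {i\<in>{1..n}. \<bar>\<xi> i \<omega>\<bar> > t})))" for \<omega> t
  have \<Psi>_meas [measurable]: "case_prod \<Psi> \<in> borel_measurable (M \<Otimes>\<^sub>M lborel)"
    unfolding \<Psi>_def[abs_def] using \<xi> by (intro borel_measurable_card_exceedances) auto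
  have layers: "(\<Sum>s\<in>?S. \<integral>\<^sup>+\<omega>'. V s \<omega> \<omega>' \<partial>M) \<le> (\<integral>\<^sup>+t\<in>{0..}. 2 ^ n * \<Psi> \<omega> t \<partial>lborel)" for \<omega>
    unfolding V_def \<Psi>_def
  proof (rule sum_sign_vectors_unif_norm_le_layers[where C = "\<lambda>k. 2 ^ n * ennreal (\<psi> (real k))"
        and v = "\<lambda>f i \<omega>. f (X i \<omega>)"])
    show "(\<lambda>\<omega>. f (X i \<omega>)) \<in> borel_measurable M" if "f \<in> F n" "i \<in> {1..n}" for f i
      using that Fn X by (auto intro: measurable_compose)
    show "(\<Sum>s\<in>?S. \<integral>\<^sup>+\<omega>. unif_norm (F n) (\<lambda>f. \<Sum>i\<in>A. s i * f (X i \<omega>)) \<partial>M)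
        \<le> 2 ^ n * ennreal (\<psi> (real (card A)))" if "A \<subseteq> {1..n}" for A
      using assms(5,7,13) by (intro sum_sign_vectors_subset_le[OF assms(1,2) perm assms(4) _ \<epsilon>X _ _ that]) auto
  qed (use Fn assms(1) in auto)
  have pow: "(2::ennreal) ^ n \<noteq> top"
    by (simp add: power_eq_top_ennreal)
  \<comment> \<open>Sum over the \<open>2\<^sup>n\<close> sign vectors; dividing by their number at the end forms the average.\<close>
  have "2 ^ n * ?E = (\<Sum>s\<in>?S. ?E)"
    by (simp add: card_sign_vectors)
  also have "\<dots> \<le> (\<Sum>s\<in>?S. 2 * (\<integral>\<^sup>+\<omega>. (\<integral>\<^sup>+\<omega>'. V s \<omega> \<omega>' \<partial>M) \<partial>M))"
    by (intro sum_mono randomize)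
  also have "\<dots> = 2 * (\<integral>\<^sup>+\<omega>. (\<Sum>s\<in>?S. \<integral>\<^sup>+\<omega>'. V s \<omega> \<omega>' \<partial>M) \<partial>M)"
    by (subst nn_integral_sum) (simp_all add: V_fst sum_distrib_left)
  also have "\<dots> \<le> 2 * (\<integral>\<^sup>+\<omega>. (\<integral>\<^sup>+t. 2 ^ n * (\<Psi> \<omega> t * indicator {0..} t) \<partial>lborel) \<partial>M)"
    using layers by (intro mult_left_mono nn_integral_mono) (simp_all add: mult_ac)
  also have "\<dots> = 2 * (\<integral>\<^sup>+\<omega>. 2 ^ n * (\<integral>\<^sup>+t\<in>{0..}. \<Psi> \<omega> t \<partial>lborel) \<partial>M)"
    by (intro arg_cong[where f = "\<lambda>x. 2 * x"] nn_integral_cong nn_integral_cmult) measurable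
  also have "\<dots> = 2 * (2 ^ n * (\<integral>\<^sup>+\<omega>. (\<integral>\<^sup>+t\<in>{0..}. \<Psi> \<omega> t \<partial>lborel) \<partial>M))"
    by (intro arg_cong[where f = "\<lambda>x. 2 * x"] nn_integral_cmult) measurable
  also have "\<dots> \<le> 2 * (2 ^ n * ?J)"
    unfolding \<Psi>_def using assms(10,11) \<xi> by (intro mult_left_mono nn_integral_layers_le assms(1)) auto
  finally have "2 ^ n * ?E \<le> 2 ^ n * (2 * ?J)"
    by (simp add: mult_ac)
  then have "?E \<le> 2 * ?J"
    using pow by (subst (asm) ennreal_mult_le_mult_iff) auto
  also have "\<dots> \<le> 4 * ?J"
    by (intro mult_right_mono) auto
  finally show ?thesis .
qed

end
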